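(* Let $\Bbbk$ be a field, let $\alpha\in\Bbbk$, and let $\mathbb{Y}$ be the $\Bbbk$-algebra generated by $y_1,y_2,x_1,x_2$ subject to the relations $$x_2x_1=x_1x_2,\quad y_2y_1=-y_1y_2,\quad y_1x_1=x_1y_1,\quad y_2x_1=x_1y_2,$$ $$y_1x_2=\alpha x_1y_1-x_2y_1+x_1y_2,\quad y_2x_2=x_1y_1+\alpha x_1y_2-x_2y_2.$$ Let $S\subset\Bbbk\{y_1,y_2,x_1,x_2\}$ be the set consisting of the six polynomials $$x_2x_1-x_1x_2,\quad y_2y_1+y_1y_2,\quad x_1y_1-y_1x_1,\quad x_1y_2-y_2x_1,$$ $$x_2y_1-y_2x_1-\alpha y_1x_1+y_1x_2,\quad x_2y_2-y_1x_1-\alpha y_2x_1+y_2x_2.$$ Then, with respect to the degree lexicographic order with $y_1\prec y_2\prec x_1\prec x_2$, the set $S$ is a Gröbner-Shirshov basis of the ideal $\mathrm{Id}(S)$, which is the ideal of defining relations of $\mathbb{Y}$, i.e. $\mathbb{Y}=\Bbbk\{y_1,y_2,x_1,x_2\}/\mathrm{Id}(S)$.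
   Context: Let $X=\{y_1,y_2,x_1,x_2\}$, let $X^*$ be the free monoid of words in $X$, and let $\Bbbk\{X\}$ be the free associative unital $\Bbbk$-algebra on $X$ (noncommutative polynomials). $\mathrm{Id}(S)$ denotes the two-sided ideal of $\Bbbk\{X\}$ generated by $S$. The degree lexicographic order $\prec$ on $X^*$ compares words first by length and then, for equal length, lexicographically from left to right with $y_1\prec y_2\prec x_1\prec x_2$. For a nonzero $f\in\Bbbk\{X\}$, $\overline{f}$ denotes its leading (i.e. $\prec$-largest) word; $f$ is monic if the coefficient of $\overline{f}$ is $1$. For monic $f,g$: (i) if $w=\overline{f}a=b\overline{g}$ with $a,b\in X^*$ and $|\overline{f}|+|\overline{g}|>|w|$, then $(f,g)_w:=fa-bg$ is the intersection composition; (ii) if $w=\overline{f}=a\overline{g}b$ with $a,b\in X^*$, then $(f,g)_w:=f-agb$ is the inclusion composition. A composition $(f,g)_w$ is trivial modulo $S$ if $(f,g)_w=\sum_i\alpha_i a_is_ib_i$ (finite sum) with $\alpha_i\in\Bbbk$, $a_i,b_i\in X^*$, $s_i\in S$ and $a_i\overline{s_i}b_i\prec w$ for all $i$. A nonempty set $S$ of monic polynomials is a Gröbner-Shirshov basis of $\mathrm{Id}(S)$ if every composition $(f,g)_w$ with $f,g\in S$ is trivial modulo $S$. *)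

theory Defs
  imports
    "HOL-Algebra.QuotRing"
    "HOL-Algebra.Module"
    "HOL-Library.Poly_Mapping"
    "HOL-Library.List_Lenlexorder"
begin

section \<open>The free associative algebra\<close>

text \<open>
  Words over \<open>'x\<close> are lists, with concatenation as monoid operation. Written additively, they
  serve as exponents of \<^typ>\<open>'a \<Rightarrow>\<^sub>0 'b\<close>, whose convolution product is then the product of
  noncommutative polynomials. Since the theory \<open>List_Lenlexorder\<close> is imported, the order \<open><\<close>
  on words is the degree lexicographic order induced by the order of the letters.
\<close>

instantiation list :: (type) monoid_add
begin

definition zero_list :: "'a list" where "zero_list = []"

definition plus_list :: "'a list \<Rightarrow> 'a list \<Rightarrow> 'a list" where "plus_list = (@)"

instance
  by standard (simp_all add: zero_list_def plus_list_def)

end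

type_synonym ('x, 'k) ncpoly = "'x list \<Rightarrow>\<^sub>0 'k"

definition word :: "'x list \<Rightarrow> ('x, 'k::field) ncpoly"
  where "word w = Poly_Mapping.single w 1"

definition scale :: "'k::field \<Rightarrow> ('x, 'k) ncpoly \<Rightarrow> ('x, 'k) ncpoly"  (infixr \<open>\<cdot>\<close> 70)
  where "c \<cdot> f = Poly_Mapping.single [] c * f"

definition free_algebra :: "('k::field, ('x, 'k) ncpoly) module"
  where "free_algebra =
    \<lparr>carrier = UNIV, monoid.mult = (*), one = 1, zero = 0, add = (+), smult = (\<cdot>)\<rparr>"

lemma word_Nil: "word [] = 1"
  by (simp add: word_def flip: zero_list_def)

lemma word_append: "word (u @ v) = word u * word v"
  by (simp add: word_def mult_single plus_list_def)

lemma lookup_scale: "Poly_Mapping.lookup (c \<cdot> f) w = c * Poly_Mapping.lookup f w"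
proof -
  have "Poly_Mapping.single 0 c * f = Poly_Mapping.map ((*) c) f"
    by (rule mult_map_scale_conv_mult [symmetric])
  then show ?thesis
    by (simp add: scale_def map.rep_eq when_def flip: zero_list_def)
qed

lemma ring_free_algebra: "ring (free_algebra :: ('k::field, ('x, 'k) ncpoly) module)"
proof (rule ringI)
  show "abelian_group (free_algebra :: ('k, ('x, 'k) ncpoly) module)"
  proof (rule abelian_groupI)
    show "\<exists>y\<in>carrier free_algebra. y \<oplus>\<^bsub>free_algebra\<^esub> x = \<zero>\<^bsub>free_algebra\<^esub>"
      for x :: "('x, 'k) ncpoly"
      by (auto simp: free_algebra_def intro: exI [of _ "- x"])
  qed (auto simp: free_algebra_def algebra_simps)
  show "monoid (free_algebra :: ('k, ('x, 'k) ncpoly) module)"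
    by unfold_locales (auto simp: free_algebra_def algebra_simps)
qed (auto simp: free_algebra_def algebra_simps)


section \<open>Presentations\<close>

text \<open>The quotient ring \<open>A Quot I\<close> together with the induced scalar multiplication.\<close>

definition quotient_algebra :: "('k, 'a, 'm) module_scheme \<Rightarrow> 'a set \<Rightarrow> ('k, 'a set) module"
  where "quotient_algebra A I =
    ring.extend (A Quot I) (module.fields (\<lambda>c X. \<Union>f\<in>X. I +>\<^bsub>A\<^esub> (c \<odot>\<^bsub>A\<^esub> f)))"

abbreviation generated_ideal :: "('x, 'k::field) ncpoly set \<Rightarrow> ('x, 'k) ncpoly set"
  where "generated_ideal S \<equiv> Idl\<^bsub>free_algebra\<^esub> S"

text \<open>A pair \<open>(l, r)\<close> stands for the defining relation \<open>l = r\<close>.\<close>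

definition defining_ideal :: "(('x, 'k::field) ncpoly \<times> ('x, 'k) ncpoly) set \<Rightarrow> ('x, 'k) ncpoly set"
  where "defining_ideal R = generated_ideal {l - r | l r. (l, r) \<in> R}"

definition presented_algebra ::
    "(('x, 'k::field) ncpoly \<times> ('x, 'k) ncpoly) set \<Rightarrow> ('k, ('x, 'k) ncpoly set) module"
  where "presented_algebra R = quotient_algebra free_algebra (defining_ideal R)"


section \<open>Groebner-Shirshov bases\<close>

definition lead_word :: "('x::linorder, 'k::field) ncpoly \<Rightarrow> 'x list"
  where "lead_word f = Max (Poly_Mapping.keys f)"

definition monic :: "('x::linorder, 'k::field) ncpoly \<Rightarrow> bool"
  where "monic f \<longleftrightarrow> f \<noteq> 0 \<and> Poly_Mapping.lookup f (lead_word f) = 1"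

text \<open>\<open>composition f g w h\<close> means that \<open>h\<close> is a composition \<open>(f, g)\<^sub>w\<close>.\<close>

inductive composition ::
    "('x::linorder, 'k::field) ncpoly \<Rightarrow> ('x, 'k) ncpoly \<Rightarrow> 'x list \<Rightarrow> ('x, 'k) ncpoly \<Rightarrow> bool"
  for f g :: "('x, 'k) ncpoly"
where
  intersection: "composition f g w (f * word a - word b * g)"
    if "w = lead_word f @ a" and "w = b @ lead_word g"
      and "length (lead_word f) + length (lead_word g) > length w"
| inclusion: "composition f g w (f - word a * g * word b)"
    if "w = lead_word f" and "w = a @ lead_word g @ b"

definition trivial_modulo ::
    "('x::linorder, 'k::field) ncpoly set \<Rightarrow> 'x list \<Rightarrow> ('x, 'k) ncpoly \<Rightarrow> bool"
  where "trivial_modulo S w h \<longleftrightarrow>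
    (\<exists>(n::nat) \<alpha> a s b.
      (\<forall>i<n. s i \<in> S \<and> a i @ lead_word (s i) @ b i < w) \<and>
      h = (\<Sum>i<n. \<alpha> i \<cdot> (word (a i) * s i * word (b i))))"

definition groebner_shirshov_basis ::
    "('x::linorder, 'k::field) ncpoly set \<Rightarrow> ('x, 'k) ncpoly set \<Rightarrow> bool"
  where "groebner_shirshov_basis S I \<longleftrightarrow>
    I = generated_ideal S \<and> S \<noteq> {} \<and> (\<forall>f\<in>S. monic f) \<and>
    (\<forall>f\<in>S. \<forall>g\<in>S. \<forall>w h. composition f g w h \<longrightarrow> trivial_modulo S w h)"


section \<open>The algebra with generators \<open>y\<^sub>1, y\<^sub>2, x\<^sub>1, x\<^sub>2\<close>\<close>

datatype gen = Y1 | Y2 | X1 | X2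

primrec gen_rank :: "gen \<Rightarrow> nat" where
  "gen_rank Y1 = 0"
| "gen_rank Y2 = 1"
| "gen_rank X1 = 2"
| "gen_rank X2 = 3"

instantiation gen :: linorder
begin

definition less_eq_gen :: "gen \<Rightarrow> gen \<Rightarrow> bool" where "u \<le> v \<longleftrightarrow> gen_rank u \<le> gen_rank v"

definition less_gen :: "gen \<Rightarrow> gen \<Rightarrow> bool" where "u < v \<longleftrightarrow> gen_rank u < gen_rank v"

instance
proof
  show "u = v" if "u \<le> v" "v \<le> u" for u v :: gen
    using that by (cases u; cases v) (simp_all add: less_eq_gen_def)
qed (auto simp: less_eq_gen_def less_gen_def)

end

definition Y_relations :: "'k::field \<Rightarrow> ((gen, 'k) ncpoly \<times> (gen, 'k) ncpoly) set"
  where "Y_relations \<alpha> =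
    (let y1 = word [Y1]; y2 = word [Y2]; x1 = word [X1]; x2 = word [X2] in
      {(x2 * x1, x1 * x2),
       (y2 * y1, - (y1 * y2)),
       (y1 * x1, x1 * y1),
       (y2 * x1, x1 * y2),
       (y1 * x2, \<alpha> \<cdot> (x1 * y1) - x2 * y1 + x1 * y2),
       (y2 * x2, x1 * y1 + \<alpha> \<cdot> (x1 * y2) - x2 * y2)})"

definition Y_algebra :: "'k::field \<Rightarrow> ('k, (gen, 'k) ncpoly set) module"
  where "Y_algebra \<alpha> = presented_algebra (Y_relations \<alpha>)"

definition Y_basis :: "'k::field \<Rightarrow> (gen, 'k) ncpoly set"
  where "Y_basis \<alpha> =
    (let y1 = word [Y1]; y2 = word [Y2]; x1 = word [X1]; x2 = word [X2] in
      {x2 * x1 - x1 * x2,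
       y2 * y1 + y1 * y2,
       x1 * y1 - y1 * x1,
       x1 * y2 - y2 * x1,
       x2 * y1 - y2 * x1 - \<alpha> \<cdot> (y1 * x1) + y1 * x2,
       x2 * y2 - y1 * x1 - \<alpha> \<cdot> (y2 * x1) + y2 * x2})"

end

theory Submission
  imports Defs
begin

text \<open>
  The leading words of the six relators are exactly the six strictly decreasing pairs
  \<open>p q\<close> of letters, \<open>q < p\<close>, so each relator says how to sort one such pair:
  \<open>p q\<close> is congruent to a combination \<open>reorder \<alpha> p q\<close> of smaller words. Since all leading
  words have length two and are pairwise distinct, a composition is either \<open>f - f = 0\<close> or comes
  from two pairs \<open>p q\<close> and \<open>q r\<close> that overlap in one letter (lemma \<open>composition_length_two\<close>), hence
  from a decreasing triple \<open>p q r\<close>. With four letters there are four such triples: \<open>x\<^sub>2 x\<^sub>1 y\<^sub>1\<close>,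
  \<open>x\<^sub>2 x\<^sub>1 y\<^sub>2\<close>, \<open>x\<^sub>1 y\<^sub>2 y\<^sub>1\<close> and \<open>x\<^sub>2 y\<^sub>2 y\<^sub>1\<close>. Sorting such a word starting with its first pair or
  starting with its last pair gives the same sorted polynomial; recording the steps of both
  computations writes the composition as a combination of multiples of relators whose leading
  words are all below \<open>p q r\<close> (lemma \<open>overlap_trivial\<close>).

  The defining relations of the algebra differ from the relators only by signs and by the use of
  \<open>x\<^sub>1 y\<^sub>i\<close> in place of \<open>y\<^sub>i x\<^sub>1\<close>; as both sets make \<open>x\<^sub>1\<close> commute with \<open>y\<^sub>1\<close> and \<open>y\<^sub>2\<close>,
  each set of generators lies in the ideal generated by the other.
\<close>

section \<open>Scalars in the free algebra\<close>

lemma scale_add_right: "c \<cdot> (f + g) = c \<cdot> f + c \<cdot> g"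
  and scale_diff_right: "c \<cdot> (f - g) = c \<cdot> f - c \<cdot> g"
  and scale_minus_right: "c \<cdot> (- f) = - (c \<cdot> f)"
  and scale_mult_left: "(c \<cdot> f) * g = c \<cdot> (f * g)"
  by (simp_all add: scale_def algebra_simps)

lemma scale_one: "1 \<cdot> f = f"
  and scale_minus_one: "(- 1) \<cdot> f = - f"
  and scale_minus_left: "(- c) \<cdot> f = - (c \<cdot> f)"
  by (rule poly_mapping_eqI, simp add: lookup_scale)+

lemma word_mult_scale_word: "word u * (c \<cdot> word v) = c \<cdot> word (u @ v)"
  by (simp add: scale_def word_def mult_single plus_list_def)

lemmas free_algebra_simps =
  scale_add_right scale_diff_right scale_minus_right scale_minus_left scale_mult_left word_mult_scale_word
  algebra_simps


section \<open>Leading words\<close>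

lemma keys_word: "Poly_Mapping.keys (word w :: ('x, 'k::field) ncpoly) = {w}"
  by (simp add: word_def)

lemma keys_scale_subset: "Poly_Mapping.keys (c \<cdot> f) \<subseteq> Poly_Mapping.keys f"
  by (auto simp: in_keys_iff lookup_scale)

lemma lead_word_monic_word_diff:
  fixes g :: "('x::linorder, 'k::field) ncpoly"
  assumes "Poly_Mapping.keys g \<subseteq> {..<w}"
  shows "lead_word (word w - g) = w" and "monic (word w - g)"
proof -
  have "w \<notin> Poly_Mapping.keys g"
    using assms by auto
  then have coeff: "Poly_Mapping.lookup (word w - g) w = 1"
    by (simp add: lookup_minus word_def in_keys_iff)
  have "Poly_Mapping.keys (word w - g) \<subseteq> Poly_Mapping.keys (word w :: ('x, 'k) ncpoly) \<union> Poly_Mapping.keys g"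
    by (rule keys_diff)
  then have "Poly_Mapping.keys (word w - g) \<subseteq> {..w}"
    using assms by (auto simp: keys_word)
  moreover have "w \<in> Poly_Mapping.keys (word w - g)"
    by (simp add: in_keys_iff coeff)
  ultimately show lead: "lead_word (word w - g) = w"
    unfolding lead_word_def by (intro Max_eqI) auto
  show "monic (word w - g)"
    using coeff by (auto simp: monic_def lead)
qed


section \<open>Compositions of polynomials with leading words of length two\<close>

text \<open>
  A list of entries \<open>(c, a, s, b)\<close> serves as an explicit certificate of triviality, which avoids
  giving coefficients and factors as functions of an index.
\<close>

lemma trivial_modulo_sum_list:
  assumes "\<And>c a s b. (c, a, s, b) \<in> set ts \<Longrightarrow> s \<in> S \<and> a @ lead_word s @ b < w"
  shows "trivial_modulo S w (\<Sum>(c, a, s, b)\<leftarrow>ts. c \<cdot> (word a * s * word b))"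
proof -
  define c where "c i = fst (ts ! i)" for i
  define a where "a i = fst (snd (ts ! i))" for i
  define s where "s i = fst (snd (snd (ts ! i)))" for i
  define b where "b i = snd (snd (snd (ts ! i)))" for i
  have nth: "ts ! i = (c i, a i, s i, b i)" for i
    by (simp add: c_def a_def s_def b_def)
  have "\<forall>i<length ts. s i \<in> S \<and> a i @ lead_word (s i) @ b i < w"
    using assms nth nth_mem by metis
  moreover have "(\<Sum>(c, a, s, b)\<leftarrow>ts. c \<cdot> (word a * s * word b)) =
      (\<Sum>i<length ts. c i \<cdot> (word (a i) * s i * word (b i)))"
    by (simp add: sum_list_sum_nth nth atLeast0LessThan)
  ultimately show ?thesis
    unfolding trivial_modulo_def by blast
qed

lemma trivial_modulo_zero: "trivial_modulo S w 0"
  using trivial_modulo_sum_list [of "[]"] by simp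

text \<open>
  The two leading words together have length four and overlap, so the word of the composition has
  length two or three: either they coincide, or they share exactly one letter. The inclusion
  composition only occurs in the first case, since the words have equal length.
\<close>

lemma composition_length_two:
  assumes "composition f g w h"
    and f: "length (lead_word f) = 2" and g: "length (lead_word g) = 2"
  obtains "lead_word f = lead_word g" and "h = f - g"
  | p q r where "lead_word f = [p, q]" "lead_word g = [q, r]" "w = [p, q, r]"
      "h = f * word [r] - word [p] * g"
  using assms(1)
proof cases
  case (intersection a b)
  obtain p q where pq: "lead_word f = [p, q]"
    using f by (auto simp: length_Suc_conv numeral_2_eq_2)
  obtain q' r where qr: "lead_word g = [q', r]"
    using g by (auto simp: length_Suc_conv numeral_2_eq_2)
  have "length a < 2" and "length a = length b"
    using intersection f g by auto (metis add_right_cancel length_append add.commute)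
  then consider "a = []" "b = []" | u v where "a = [u]" "b = [v]"
    by (cases a; cases b) auto
  then show ?thesis
  proof cases
    case 1
    then show ?thesis
      using intersection that(1) by (simp add: word_Nil)
  next
    case 2
    then show ?thesis
      using intersection pq qr that(2) by auto
  qed
next
  case (inclusion a b)
  then have "a = []" "b = []"
    using f g by (metis add_eq_self_zero add_is_0 length_0_conv length_append add.left_commute)+
  then show ?thesis
    using inclusion that(1) by (simp add: word_Nil)
qed


section \<open>The relators as sorting rules\<close>

text \<open>
  The right-hand sides of the sorting rules, as one family indexed by pairs of letters rather than
  as six separate polynomials, so that leading words and overlaps become statements about
  decreasing pairs and triples. Pairs that are already sorted get the default value \<open>0\<close>.
\<close>

fun reorder :: "'k::field \<Rightarrow> gen \<Rightarrow> gen \<Rightarrow> (gen, 'k) ncpoly" where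
  "reorder \<alpha> X2 X1 = word [X1, X2]"
| "reorder \<alpha> Y2 Y1 = - word [Y1, Y2]"
| "reorder \<alpha> X1 Y1 = word [Y1, X1]"
| "reorder \<alpha> X1 Y2 = word [Y2, X1]"
| "reorder \<alpha> X2 Y1 = word [Y2, X1] + \<alpha> \<cdot> word [Y1, X1] - word [Y1, X2]"
| "reorder \<alpha> X2 Y2 = word [Y1, X1] + \<alpha> \<cdot> word [Y2, X1] - word [Y2, X2]"
| "reorder \<alpha> p q = 0"

definition relator :: "'k::field \<Rightarrow> gen \<Rightarrow> gen \<Rightarrow> (gen, 'k) ncpoly"
  where "relator \<alpha> p q = word [p, q] - reorder \<alpha> p q"

lemma decreasing_pair_cases:
  assumes "q < p"
  obtains "p = X2" "q = X1" | "p = Y2" "q = Y1" | "p = X1" "q = Y1" | "p = X1" "q = Y2"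
    | "p = X2" "q = Y1" | "p = X2" "q = Y2"
  using assms by (cases p; cases q) (auto simp: less_gen_def)

lemma keys_reorder_subset:
  fixes \<alpha> :: "'k::field"
  assumes "q < p"
  shows "Poly_Mapping.keys (reorder \<alpha> p q) \<subseteq> {..<[p, q]}"
proof -
  have add: "Poly_Mapping.keys (f + g) \<subseteq> A" and diff: "Poly_Mapping.keys (f - g) \<subseteq> A"
    if "Poly_Mapping.keys f \<subseteq> A" "Poly_Mapping.keys g \<subseteq> A" for f g :: "(gen, 'k) ncpoly" and A
    using that keys_add [of f g] keys_diff [of f g] by blast+
  have scale: "Poly_Mapping.keys (c \<cdot> f) \<subseteq> A" if "Poly_Mapping.keys f \<subseteq> A" for c and f :: "(gen, 'k) ncpoly" and A
    using that keys_scale_subset by blast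
  have minus: "Poly_Mapping.keys (- f) \<subseteq> A" if "Poly_Mapping.keys f \<subseteq> A" for f :: "(gen, 'k) ncpoly" and A
    using that by simp
  have word: "Poly_Mapping.keys (word u :: (gen, 'k) ncpoly) \<subseteq> {..<w}" if "u < w" for u w :: "gen list"
    using that by (simp add: keys_word)
  show ?thesis
    using assms
    by (rule decreasing_pair_cases; simp only: reorder.simps; intro add diff scale minus word;
        simp add: less_gen_def list_less_def Cons_lenlex_iff)
qed

lemma lead_word_relator: "q < p \<Longrightarrow> lead_word (relator \<alpha> p q) = [p, q]"
  and monic_relator: "q < p \<Longrightarrow> monic (relator \<alpha> p q)"
  unfolding relator_def by (simp_all add: lead_word_monic_word_diff keys_reorder_subset)

lemma Y_basis_eq: "Y_basis \<alpha> = {relator \<alpha> p q |p q. q < p}"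
proof -
  have "{relator \<alpha> p q |p q. q < p} =
      {relator \<alpha> X2 X1, relator \<alpha> Y2 Y1, relator \<alpha> X1 Y1, relator \<alpha> X1 Y2,
       relator \<alpha> X2 Y1, relator \<alpha> X2 Y2}"
    by (rule equalityI)
      (auto elim!: decreasing_pair_cases,
        (rule exI, rule exI, rule conjI, rule refl, simp add: less_gen_def)+)
  then show ?thesis
    by (simp add: Y_basis_def Let_def relator_def algebra_simps flip: word_append)
qed


section \<open>The four overlaps\<close>

lemma decreasing_triple_cases:
  assumes "q < p" and "r < q"
  obtains "p = X2" "q = X1" "r = Y1" | "p = X2" "q = X1" "r = Y2"
    | "p = X1" "q = Y2" "r = Y1" | "p = X2" "q = Y2" "r = Y1"
  using assms by (cases p; cases q; cases r) (auto simp: less_gen_def)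

text \<open>
  The leading words \<open>p q r\<close> cancel in the composition, which leaves
  \<open>p (reorder \<alpha> q r) - (reorder \<alpha> p q) r\<close>. The lists in the proof record how this
  polynomial is sorted to \<open>0\<close>: an entry \<open>(c, a, (u, v), b)\<close> replaces the word \<open>a u v b\<close>, whose
  coefficient at that moment is \<open>c\<close>, and thereby subtracts \<open>c\<close> times \<open>a (relator \<alpha> u v) b\<close>.
  All words that occur are smaller than \<open>p q r\<close> because every replacement makes words smaller.
\<close>

lemma overlap_trivial:
  fixes \<alpha> :: "'k::field"
  assumes "q < p" and "r < q"
  shows "trivial_modulo (Y_basis \<alpha>) [p, q, r]
    (relator \<alpha> p q * word [r] - word [p] * relator \<alpha> q r)"
proof -
  have trivial: "trivial_modulo (Y_basis \<alpha>) w h"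
    if "h = (\<Sum>(c, a, (p, q), b)\<leftarrow>ts. c \<cdot> (word a * relator \<alpha> p q * word b))"
      and "\<forall>(c, a, (p, q), b)\<in>set ts. q < p \<and> a @ [p, q] @ b < w"
    for h w and ts :: "('k \<times> gen list \<times> (gen \<times> gen) \<times> gen list) list"
  proof -
    have "trivial_modulo (Y_basis \<alpha>) w (\<Sum>(c, a, s, b)\<leftarrow>
        map (\<lambda>(c, a, (p, q), b). (c, a, relator \<alpha> p q, b)) ts. c \<cdot> (word a * s * word b))"
      using that(2)
      by (intro trivial_modulo_sum_list) (fastforce simp: Y_basis_eq lead_word_relator)
    then show ?thesis
      by (simp add: that(1) comp_def case_prod_unfold)
  qed
  note expand = relator_def scale_minus_one scale_one word_Nil free_algebra_simps
  show ?thesis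
    using assms
  proof (cases rule: decreasing_triple_cases)
    case 1
    show ?thesis
      unfolding 1
      by (rule trivial [where ts =
          "[(- 1, [X1], (X2, Y1), []), (1, [], (X2, Y1), [X1]), (- 1, [], (X1, Y2), [X1]),
            (- \<alpha>, [], (X1, Y1), [X1]), (1, [], (X1, Y1), [X2]), (- 1, [Y1], (X2, X1), [])]"])
        (simp_all add: expand less_gen_def list_less_def Cons_lenlex_iff flip: word_append)
  next
    case 2
    show ?thesis
      unfolding 2
      by (rule trivial [where ts =
          "[(- 1, [X1], (X2, Y2), []), (1, [], (X2, Y2), [X1]), (- 1, [], (X1, Y1), [X1]),
            (- \<alpha>, [], (X1, Y2), [X1]), (1, [], (X1, Y2), [X2]), (- 1, [Y2], (X2, X1), [])]"])
        (simp_all add: expand less_gen_def list_less_def Cons_lenlex_iff flip: word_append)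
  next
    case 3
    show ?thesis
      unfolding 3
      by (rule trivial [where ts =
          "[(- 1, [Y2], (X1, Y1), []), (- 1, [], (X1, Y1), [Y2]), (- 1, [Y1], (X1, Y2), []),
            (- 1, [], (Y2, Y1), [X1])]"])
        (simp_all add: expand less_gen_def list_less_def Cons_lenlex_iff flip: word_append)
  next
    case 4
    show ?thesis
      unfolding 4
      by (rule trivial [where ts =
          "[(- 1, [Y1], (X1, Y1), []), (- \<alpha>, [Y2], (X1, Y1), []), (1, [Y2], (X2, Y1), []),
            (- 1, [], (X2, Y1), [Y2]), (- 1, [Y2], (X1, Y2), []), (- \<alpha>, [Y1], (X1, Y2), []),
            (1, [Y1], (X2, Y2), []), (- 1, [], (Y2, Y1), [X2])]"])
        (simp_all add: expand less_gen_def list_less_def Cons_lenlex_iff flip: word_append)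
  qed
qed

lemma groebner_shirshov_basis_Y_basis:
  "groebner_shirshov_basis (Y_basis \<alpha>) (generated_ideal (Y_basis \<alpha>))"
  unfolding groebner_shirshov_basis_def
proof (intro conjI ballI allI impI)
  show "Y_basis \<alpha> \<noteq> {}"
    by (simp add: Y_basis_def Let_def)
  show "monic f" if "f \<in> Y_basis \<alpha>" for f
    using that by (auto simp: Y_basis_eq monic_relator)
  fix f g w h
  assume "f \<in> Y_basis \<alpha>" and "g \<in> Y_basis \<alpha>" and comp: "composition f g w h"
  then obtain p q p' q' where f: "f = relator \<alpha> p q" "q < p" and g: "g = relator \<alpha> p' q'" "q' < p'"
    unfolding Y_basis_eq by blast
  from comp show "trivial_modulo (Y_basis \<alpha>) w h"
  proof (rule composition_length_two)
    assume "lead_word f = lead_word g" and "h = f - g"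
    then show ?thesis
      using f g by (simp add: lead_word_relator trivial_modulo_zero)
  next
    fix u v r
    assume "lead_word f = [u, v]" "lead_word g = [v, r]" "w = [u, v, r]"
      "h = f * word [r] - word [u] * g"
    then show ?thesis
      using f g overlap_trivial by (simp add: lead_word_relator)
  qed (use f g in \<open>simp_all add: lead_word_relator\<close>)
qed simp


section \<open>The ideal of defining relations\<close>

lemma generated_ideal_closed:
  fixes S :: "('x, 'k::field) ncpoly set"
  shows generated_ideal_generator: "f \<in> S \<Longrightarrow> f \<in> generated_ideal S"
    and generated_ideal_add:
      "f \<in> generated_ideal S \<Longrightarrow> g \<in> generated_ideal S \<Longrightarrow> f + g \<in> generated_ideal S"
    and generated_ideal_scale: "f \<in> generated_ideal S \<Longrightarrow> c \<cdot> f \<in> generated_ideal S"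
    and generated_ideal_minus: "f \<in> generated_ideal S \<Longrightarrow> - f \<in> generated_ideal S"
    and generated_ideal_diff:
      "f \<in> generated_ideal S \<Longrightarrow> g \<in> generated_ideal S \<Longrightarrow> f - g \<in> generated_ideal S"
proof -
  interpret R: ring "free_algebra :: ('k, ('x, 'k) ncpoly) module"
    by (rule ring_free_algebra)
  have UNIV: "S \<subseteq> carrier free_algebra"
    by (simp add: free_algebra_def)
  interpret I: ideal "generated_ideal S" "free_algebra :: ('k, ('x, 'k) ncpoly) module"
    by (rule R.genideal_ideal [OF UNIV])
  show "f \<in> generated_ideal S" if "f \<in> S" for f
    using R.genideal_self [OF UNIV] that by blast
  show add: "f + g \<in> generated_ideal S" if "f \<in> generated_ideal S" "g \<in> generated_ideal S" for f g
    using I.a_closed [OF that] by (simp add: free_algebra_def)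
  show scale: "c \<cdot> f \<in> generated_ideal S" if "f \<in> generated_ideal S" for c f
    using I.I_l_closed [OF that, of "Poly_Mapping.single [] c"]
    by (simp add: free_algebra_def scale_def)
  show minus: "- f \<in> generated_ideal S" if "f \<in> generated_ideal S" for f
    using scale [OF that, of "- 1"] by (simp add: scale_minus_one)
  show "f - g \<in> generated_ideal S" if "f \<in> generated_ideal S" "g \<in> generated_ideal S" for f g
    using add [OF that(1) minus [OF that(2)]] by simp
qed

lemma generated_ideal_subset:
  assumes "S \<subseteq> generated_ideal T"
  shows "generated_ideal S \<subseteq> generated_ideal T"
  using assms ring.genideal_minimal [OF ring_free_algebra]
    ring.genideal_ideal [OF ring_free_algebra, of T]
  by (auto simp: free_algebra_def)

lemma defining_ideal_Y_relations:
  fixes \<alpha> :: "'k::field"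
  shows "defining_ideal (Y_relations \<alpha>) = generated_ideal (Y_basis \<alpha>)"
proof -
  define D where "D = {l - r |l r. (l, r) \<in> Y_relations \<alpha>}"
  have D: "D =
      {word [X2, X1] - word [X1, X2],
       word [Y2, Y1] + word [Y1, Y2],
       word [Y1, X1] - word [X1, Y1],
       word [Y2, X1] - word [X1, Y2],
       word [Y1, X2] - (\<alpha> \<cdot> word [X1, Y1] - word [X2, Y1] + word [X1, Y2]),
       word [Y2, X2] - (word [X1, Y1] + \<alpha> \<cdot> word [X1, Y2] - word [X2, Y2])}"
    (is "_ = {?d1, ?d2, ?d3, ?d4, ?d5, ?d6}")
  proof -
    have "D = (\<lambda>(l, r). l - r) ` Y_relations \<alpha>"
      unfolding D_def by force
    then show ?thesis
      by (simp add: Y_relations_def Let_def flip: word_append)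
  qed
  note closed = generated_ideal_add generated_ideal_scale generated_ideal_minus
    generated_ideal_diff
  have "relator \<alpha> X2 X1 = ?d1" "relator \<alpha> Y2 Y1 = ?d2"
    "relator \<alpha> X1 Y1 = - ?d3" "relator \<alpha> X1 Y2 = - ?d4"
    "relator \<alpha> X2 Y1 = ?d5 - ?d4 - \<alpha> \<cdot> ?d3" "relator \<alpha> X2 Y2 = ?d6 - ?d3 - \<alpha> \<cdot> ?d4"
    by (simp_all add: relator_def free_algebra_simps)
  moreover have "?d1 \<in> generated_ideal D" "?d2 \<in> generated_ideal D" "?d3 \<in> generated_ideal D"
    "?d4 \<in> generated_ideal D" "?d5 \<in> generated_ideal D" "?d6 \<in> generated_ideal D"
    by (rule generated_ideal_generator, simp add: D)+
  ultimately have "relator \<alpha> p q \<in> generated_ideal D" if "q < p" for p q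
    using that by - (erule decreasing_pair_cases; simp only: closed)
  then have "Y_basis \<alpha> \<subseteq> generated_ideal D"
    by (auto simp: Y_basis_eq)
  have "?d1 = relator \<alpha> X2 X1" "?d2 = relator \<alpha> Y2 Y1"
    "?d3 = - relator \<alpha> X1 Y1" "?d4 = - relator \<alpha> X1 Y2"
    "?d5 = relator \<alpha> X2 Y1 - relator \<alpha> X1 Y2 - \<alpha> \<cdot> relator \<alpha> X1 Y1"
    "?d6 = relator \<alpha> X2 Y2 - relator \<alpha> X1 Y1 - \<alpha> \<cdot> relator \<alpha> X1 Y2"
    by (simp_all add: relator_def free_algebra_simps)
  moreover have "relator \<alpha> p q \<in> generated_ideal (Y_basis \<alpha>)" if "q < p" for p q
    by (rule generated_ideal_generator) (use that in \<open>auto simp: Y_basis_eq\<close>)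
  then have "relator \<alpha> X2 X1 \<in> generated_ideal (Y_basis \<alpha>)"
    "relator \<alpha> Y2 Y1 \<in> generated_ideal (Y_basis \<alpha>)"
    "relator \<alpha> X1 Y1 \<in> generated_ideal (Y_basis \<alpha>)"
    "relator \<alpha> X1 Y2 \<in> generated_ideal (Y_basis \<alpha>)"
    "relator \<alpha> X2 Y1 \<in> generated_ideal (Y_basis \<alpha>)"
    "relator \<alpha> X2 Y2 \<in> generated_ideal (Y_basis \<alpha>)"
    by (simp_all add: less_gen_def)
  ultimately have "D \<subseteq> generated_ideal (Y_basis \<alpha>)"
    unfolding D by (simp only: closed insert_subset empty_subsetI simp_thms)
  with \<open>Y_basis \<alpha> \<subseteq> generated_ideal D\<close> show ?thesis
    unfolding defining_ideal_def D_def [symmetric]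
    by (intro equalityI generated_ideal_subset)
qed

theorem mainTheorem12:
  fixes \<alpha> :: "'k::field"
  shows "groebner_shirshov_basis (Y_basis \<alpha>) (generated_ideal (Y_basis \<alpha>)) \<and>
    defining_ideal (Y_relations \<alpha>) = generated_ideal (Y_basis \<alpha>) \<and>
    Y_algebra \<alpha> = quotient_algebra free_algebra (generated_ideal (Y_basis \<alpha>))"
  by (simp add: groebner_shirshov_basis_Y_basis defining_ideal_Y_relations
      Y_algebra_def presented_algebra_def)

end
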